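(* The Baumslag–Solitar group $G_2=BS(1,2)=\langle a,b\mid bab^{-1}=a^2\rangle$ is $6$-chordal with respect to the generating set $\{a,b\}$.
   Context: For a group $G$ with finite generating set $S$, $S^{\pm1}=S\cup S^{-1}\setminus\{e\}$. A relation $s_1\cdots s_n=e$ with $n>2$, $s_i\in S^{\pm1}$, is simple if $s_p\cdots s_q=e$ holds exactly when $(p,q)=(1,n)$. $G$ is $k$-chordal with respect to $S$ if for every simple relation $s_1\cdots s_n=e$ with $n\ge k$ there exist $1\le i<j\le n$ and $s'_1,\dots,s'_r\in S^{\pm1}$ with $s_i\cdots s_j=s'_1\cdots s'_r$ and $r\le\min\{j-i,\,n-j+i-2\}$ (equivalently, every cycle of length at least $k$ in the Cayley graph $Cay(G,S)$ has a shortcut: a path between two of its vertices $p,q$ strictly shorter than their distance along the cycle). *)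

theory Defs
  imports Main
begin

datatype letter = A | B | Ai | Bi

fun linv :: "letter \<Rightarrow> letter" where
  "linv A = Ai" | "linv Ai = A" | "linv B = Bi" | "linv Bi = B"

definition bs_relator :: "letter list" where
  "bs_relator = [B, A, Bi, Ai, Ai]"

text \<open>Equality of group elements represented by words: the congruence on words
  generated by free cancellation and the defining relator (presentation).\<close>
inductive bs_eq :: "letter list \<Rightarrow> letter list \<Rightarrow> bool" where
  refl: "bs_eq w w"
| sym: "bs_eq u v \<Longrightarrow> bs_eq v u"
| trans: "bs_eq u v \<Longrightarrow> bs_eq v w \<Longrightarrow> bs_eq u w"
| cancel: "bs_eq (u @ [x, linv x] @ v) (u @ v)"
| relator: "bs_eq (u @ bs_relator @ v) (u @ v)"

text \<open>Generic notions for a group given by words over letters, with word equality eq.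
  S^{+-1}: letters representing a non-identity element.\<close>
definition nontriv :: "('l list \<Rightarrow> 'l list \<Rightarrow> bool) \<Rightarrow> 'l \<Rightarrow> bool" where
  "nontriv eq x \<longleftrightarrow> \<not> eq [x] []"

text \<open>Segment s_p ... s_q of a word (0-indexed, inclusive).\<close>
definition seg :: "'l list \<Rightarrow> nat \<Rightarrow> nat \<Rightarrow> 'l list" where
  "seg w p q = take (Suc q - p) (drop p w)"

definition simple_relation :: "('l list \<Rightarrow> 'l list \<Rightarrow> bool) \<Rightarrow> 'l list \<Rightarrow> bool" where
  "simple_relation eq w \<longleftrightarrow>
     length w > 2 \<and> (\<forall>x\<in>set w. nontriv eq x) \<and>
     (\<forall>p q. p \<le> q \<and> q < length w \<longrightarrow>
        (eq (seg w p q) [] \<longleftrightarrow> (p = 0 \<and> q = length w - 1)))"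

definition k_chordal :: "('l list \<Rightarrow> 'l list \<Rightarrow> bool) \<Rightarrow> nat \<Rightarrow> bool" where
  "k_chordal eq k \<longleftrightarrow>
     (\<forall>w. simple_relation eq w \<and> length w \<ge> k \<longrightarrow>
        (\<exists>i j w'. i < j \<and> j < length w \<and> (\<forall>x\<in>set w'. nontriv eq x) \<and>
           eq (seg w i j) w' \<and>
           int (length w') \<le> min (int j - int i) (int (length w) - int j + int i - 2)))"

end

theory Submission
  imports Defs Complex_Main
begin

text \<open>
  The group acts faithfully on the line by \<open>a: y \<mapsto> y + 1\<close> and \<open>b: y \<mapsto> 2 y\<close>, so equality of words
  can be tested on affine maps. The height of a word is its exponent sum in \<open>b\<close>.

  Suppose a cycle of length \<open>n \<ge> 6\<close> has no shortcut; then neither have its rotations and its image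
  under \<open>a \<leftrightarrow> a\<^sup>-\<^sup>1\<close>. Start it at minimal height. It is then a product of excursions
  \<open>U = b X b\<^sup>-\<^sup>1\<close> above that height, which are even powers of \<open>a\<close>, separated by single letters
  \<open>a\<^sup>\<plusminus>\<^sup>1\<close>; by parity the number of excursions is even. A segment \<open>U a\<^sup>\<plusminus>\<^sup>1 U'\<close> can be shortened by two
  letters, since excursions commute with \<open>a\<close>. Four or more excursions give two disjoint such segments, one of
  length at most \<open>n/2\<close>. If there are just two excursions, they have almost the same length,
  so they contain no such segment either, and hence each has a single peak. The peaks \<open>a\<^sup>k\<close> and
  \<open>a\<^sup>-\<^sup>l\<close> have opposite signs, and cancelling letters of one against letters of the
  other shortens one of the two segments joining them.
\<close>

section \<open>The affine representation is faithful\<close>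

fun act :: "letter list \<Rightarrow> real \<Rightarrow> real" where
  "act [] y = y"
| "act (A # w) y = act w y + 1"
| "act (Ai # w) y = act w y - 1"
| "act (B # w) y = 2 * act w y"
| "act (Bi # w) y = act w y / 2"

lemma act_append [simp]: "act (u @ v) y = act u (act v y)"
  by (induction u y rule: act.induct) auto

lemma bs_eq_imp_act: "bs_eq u v \<Longrightarrow> act u = act v"
proof (induction rule: bs_eq.induct)
  case (cancel u x v)
  show ?case by (cases x) (auto simp: fun_eq_iff)
next
  case (relator u v)
  then show ?case by (auto simp: fun_eq_iff bs_relator_def diff_divide_distrib)
qed auto

section \<open>Rewriting in the presentation towards b^-i a^m b^j\<close>

lemma bs_eq_context: "bs_eq u v \<Longrightarrow> bs_eq (x @ u @ y) (x @ v @ y)"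
proof (induction rule: bs_eq.induct)
  case (cancel u z v)
  show ?case using bs_eq.cancel[of "x @ u" z "v @ y"] by simp
next
  case (relator u v)
  show ?case using bs_eq.relator[of "x @ u" "v @ y"] by simp
qed (auto intro: bs_eq.intros)

lemma bs_eq_Cons: "bs_eq u v \<Longrightarrow> bs_eq (x # u) (x # v)"
  using bs_eq_context[of u v "[x]" "[]"] by simp

lemma bs_eq_append_left: "bs_eq u v \<Longrightarrow> bs_eq (x @ u) (x @ v)"
  using bs_eq_context[of u v x "[]"] by simp

lemma bs_eq_append_right: "bs_eq u v \<Longrightarrow> bs_eq (u @ y) (v @ y)"
  using bs_eq_context[of u v "[]" y] by simp

declare bs_eq.trans [trans]

lemma bs_eq_cancel_Cons:
  "bs_eq (A # Ai # w) w" "bs_eq (Ai # A # w) w" "bs_eq (B # Bi # w) w" "bs_eq (Bi # B # w) w"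
  using bs_eq.cancel[of "[]" A w] bs_eq.cancel[of "[]" Ai w]
    bs_eq.cancel[of "[]" B w] bs_eq.cancel[of "[]" Bi w] by simp_all

text \<open>Trivial pairs are inserted until \<open>bs_relator\<close> appears as a subword and can
  be deleted.\<close>

lemma bs_eq_B_A: "bs_eq (B # A # w) (A # A # B # w)"
proof -
  have "bs_eq (B # A # w) (B # A # Bi # B # w)"
    by (intro bs_eq_Cons bs_eq.sym[OF bs_eq_cancel_Cons(4)])
  also have "bs_eq \<dots> (B # A # Bi # Ai # A # B # w)"
    by (intro bs_eq_Cons bs_eq.sym[OF bs_eq_cancel_Cons(2)])
  also have "bs_eq \<dots> (B # A # Bi # Ai # Ai # A # A # B # w)"
    by (intro bs_eq_Cons bs_eq.sym[OF bs_eq_cancel_Cons(2)])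
  also have "bs_eq \<dots> (A # A # B # w)"
    using bs_eq.relator[of "[]" "A # A # B # w"] by (simp add: bs_relator_def)
  finally show ?thesis .
qed

lemma bs_eq_A_Bi: "bs_eq (A # Bi # w) (Bi # A # A # w)"
proof -
  have "bs_eq (A # Bi # w) (Bi # B # A # Bi # w)"
    by (rule bs_eq.sym[OF bs_eq_cancel_Cons(4)])
  also have "bs_eq \<dots> (Bi # A # A # B # Bi # w)"
    by (intro bs_eq_Cons bs_eq_B_A)
  also have "bs_eq \<dots> (Bi # A # A # w)"
    by (intro bs_eq_Cons bs_eq_cancel_Cons)
  finally show ?thesis .
qed

lemma bs_eq_Ai_Bi: "bs_eq (Ai # Bi # w) (Bi # Ai # Ai # w)"
proof (rule bs_eq.sym)
  have "bs_eq (Bi # Ai # Ai # w) (Ai # A # Bi # Ai # Ai # w)"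
    by (rule bs_eq.sym[OF bs_eq_cancel_Cons(2)])
  also have "bs_eq \<dots> (Ai # Bi # A # A # Ai # Ai # w)"
    by (intro bs_eq_Cons bs_eq_A_Bi)
  also have "bs_eq \<dots> (Ai # Bi # A # Ai # w)"
    by (intro bs_eq_Cons bs_eq_cancel_Cons)
  also have "bs_eq \<dots> (Ai # Bi # w)"
    by (intro bs_eq_Cons bs_eq_cancel_Cons)
  finally show "bs_eq (Bi # Ai # Ai # w) (Ai # Bi # w)" .
qed

lemma bs_eq_B_Ai: "bs_eq (B # Ai # w) (Ai # Ai # B # w)"
proof (rule bs_eq.sym)
  have "bs_eq (Ai # Ai # B # w) (Ai # Ai # B # A # Ai # w)"
    by (intro bs_eq_Cons bs_eq.sym[OF bs_eq_cancel_Cons(1)])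
  also have "bs_eq \<dots> (Ai # Ai # A # A # B # Ai # w)"
    by (intro bs_eq_Cons bs_eq_B_A)
  also have "bs_eq \<dots> (Ai # A # B # Ai # w)"
    by (intro bs_eq_Cons bs_eq_cancel_Cons)
  also have "bs_eq \<dots> (B # Ai # w)"
    by (intro bs_eq_Cons bs_eq_cancel_Cons)
  finally show "bs_eq (Ai # Ai # B # w) (B # Ai # w)" .
qed

definition apow :: "int \<Rightarrow> letter list" where
  "apow m = (if 0 \<le> m then replicate (nat m) A else replicate (nat (- m)) Ai)"

lemma act_replicate [simp]:
  "act (replicate k A) y = y + k" "act (replicate k Ai) y = y - k"
  "act (replicate k B) y = 2 ^ k * y" "act (replicate k Bi) y = y / 2 ^ k"
  by (induction k) auto

lemma act_apow [simp]: "act (apow m) y = y + m"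
  by (simp add: apow_def)

lemma bs_eq_A_apow: "bs_eq (A # apow m @ w) (apow (m + 1) @ w)"
proof (cases "0 \<le> m")
  case True
  then have "nat (m + 1) = Suc (nat m)" by simp
  with True show ?thesis by (simp add: apow_def bs_eq.refl)
next
  case False
  then have "nat (- m) = Suc (nat (- (m + 1)))" by simp
  with False have "apow m = Ai # apow (m + 1)" by (auto simp: apow_def)
  then show ?thesis by (simp add: bs_eq_cancel_Cons)
qed

lemma bs_eq_Ai_apow: "bs_eq (Ai # apow m @ w) (apow (m - 1) @ w)"
proof (cases "m \<le> 0")
  case True
  then have "nat (1 - m) = Suc (nat (- m))" by simp
  with True show ?thesis by (auto simp add: apow_def bs_eq.refl)
next
  case False
  then have "apow m = A # apow (m - 1)"
    by (auto simp: apow_def simp flip: replicate_Suc intro!: arg_cong2[where f = replicate])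
  then show ?thesis by (simp add: bs_eq_cancel_Cons)
qed

lemma bs_eq_A_Bi_power: 
  "bs_eq (A # replicate i Bi @ apow m @ w) (replicate i Bi @ apow (m + 2 ^ i) @ w)"
proof (induction i arbitrary: m)
  case 0
  show ?case by (simp add: bs_eq_A_apow)
next
  case (Suc i)
  have "bs_eq (A # replicate (Suc i) Bi @ apow m @ w) (Bi # A # A # replicate i Bi @ apow m @ w)"
    using bs_eq_A_Bi by simp
  also have "bs_eq \<dots> (Bi # A # replicate i Bi @ apow (m + 2 ^ i) @ w)"
    by (intro bs_eq_Cons Suc)
  also have "bs_eq \<dots> (Bi # replicate i Bi @ apow (m + 2 ^ i + 2 ^ i) @ w)"
    by (intro bs_eq_Cons Suc)
  finally show ?case by (simp add: algebra_simps)
qed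

lemma bs_eq_Ai_Bi_power: 
  "bs_eq (Ai # replicate i Bi @ apow m @ w) (replicate i Bi @ apow (m - 2 ^ i) @ w)"
proof (induction i arbitrary: m)
  case 0
  show ?case by (simp add: bs_eq_Ai_apow)
next
  case (Suc i)
  have "bs_eq (Ai # replicate (Suc i) Bi @ apow m @ w) (Bi # Ai # Ai # replicate i Bi @ apow m @ w)"
    using bs_eq_Ai_Bi by simp
  also have "bs_eq \<dots> (Bi # Ai # replicate i Bi @ apow (m - 2 ^ i) @ w)"
    by (intro bs_eq_Cons Suc)
  also have "bs_eq \<dots> (Bi # replicate i Bi @ apow (m - 2 ^ i - 2 ^ i) @ w)"
    by (intro bs_eq_Cons Suc)
  finally show ?case by (simp add: algebra_simps)
qed

lemma bs_eq_B_A_power: "bs_eq (B # replicate k A @ w) (replicate (2 * k) A @ B # w)"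
proof (induction k)
  case (Suc k)
  have "bs_eq (B # replicate (Suc k) A @ w) (A # A # B # replicate k A @ w)"
    using bs_eq_B_A by simp
  also have "bs_eq \<dots> (A # A # replicate (2 * k) A @ B # w)"
    by (intro bs_eq_Cons Suc)
  finally show ?case by simp
qed (simp add: bs_eq.refl)

lemma bs_eq_B_Ai_power: "bs_eq (B # replicate k Ai @ w) (replicate (2 * k) Ai @ B # w)"
proof (induction k)
  case (Suc k)
  have "bs_eq (B # replicate (Suc k) Ai @ w) (Ai # Ai # B # replicate k Ai @ w)"
    using bs_eq_B_Ai by simp
  also have "bs_eq \<dots> (Ai # Ai # replicate (2 * k) Ai @ B # w)"
    by (intro bs_eq_Cons Suc)
  finally show ?case by simp
qed (simp add: bs_eq.refl)

lemma bs_eq_B_apow: "bs_eq (B # apow m @ w) (apow (2 * m) @ B # w)"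
  using bs_eq_B_A_power[of "nat m" w] bs_eq_B_Ai_power[of "nat (- m)" w]
  by (simp add: apow_def nat_mult_distrib flip: mult_minus_right)

text \<open>A letter in front of b^-i a^m b^j is absorbed: a passes b^-i as a^(2^i), and b either
  cancels one b^-1 or, if i = 0, passes a^m and doubles m. The form is not unique (b^-1 a^2 b = a),
  but its affine map is explicit.\<close>

lemma bs_normal_form: "\<exists>i m j. bs_eq w (replicate i Bi @ apow m @ replicate j B)"
proof (induction w)
  case Nil
  have "bs_eq [] (replicate 0 Bi @ apow 0 @ replicate 0 B)"
    by (simp add: apow_def bs_eq.refl)
  then show ?case by blast
next
  case (Cons x w)
  then obtain i m j where "bs_eq w (replicate i Bi @ apow m @ replicate j B)" by blast
  then have *: "bs_eq (x # w) (x # replicate i Bi @ apow m @ replicate j B)"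
    by (rule bs_eq_Cons)
  show ?case
  proof (cases x)
    case A
    then show ?thesis using bs_eq.trans[OF *] bs_eq_A_Bi_power by blast
  next
    case Ai
    then show ?thesis using bs_eq.trans[OF *] bs_eq_Ai_Bi_power by blast
  next
    case Bi
    then have "bs_eq (x # w) (replicate (Suc i) Bi @ apow m @ replicate j B)"
      using * by simp
    then show ?thesis by blast
  next
    case B
    show ?thesis
    proof (cases i)
      case 0
      then have "bs_eq (x # w) (B # apow m @ replicate j B)" using * B by simp
      also have "bs_eq \<dots> (apow (2 * m) @ B # replicate j B)" by (rule bs_eq_B_apow)
      finally have "bs_eq (x # w) (replicate 0 Bi @ apow (2 * m) @ replicate (Suc j) B)" by simp
      then show ?thesis by blast
    next
      case (Suc i')
      then have "bs_eq (x # w) (B # Bi # replicate i' Bi @ apow m @ replicate j B)"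
        using * B by simp
      also have "bs_eq \<dots> (replicate i' Bi @ apow m @ replicate j B)"
        by (rule bs_eq_cancel_Cons)
      finally show ?thesis by blast
    qed
  qed
qed

lemma bs_eq_Bi_B_power: "bs_eq (replicate i Bi @ replicate i B) []"
proof (induction i)
  case (Suc i)
  have "replicate (Suc i) Bi @ replicate (Suc i) B = replicate i Bi @ Bi # B # replicate i B"
    by (simp add: replicate_app_Cons_same)
  also have "bs_eq \<dots> (replicate i Bi @ replicate i B)"
    by (intro bs_eq_append_left bs_eq_cancel_Cons)
  also note Suc
  finally show ?case .
qed (simp add: bs_eq.refl)

text \<open>The normal form acts by (2^j y + m) / 2^i; its values at 0 and 1 force m = 0 and i = j,
  and then b^-i b^i cancels.\<close>

lemma act_id_imp_bs_eq:
  assumes "act w = id"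
  shows "bs_eq w []"
proof -
  obtain i m j where nf: "bs_eq w (replicate i Bi @ apow m @ replicate j B)"
    using bs_normal_form by blast
  have y: "(2 ^ j * y + m) / 2 ^ i = y" for y :: real
    using bs_eq_imp_act[OF nf] assms by (simp add: fun_eq_iff)
  have "m = 0" using y[of 0] by simp
  moreover from this have "(2::real) ^ j = 2 ^ i" using y[of 1] by (simp add: field_simps)
  ultimately have "bs_eq w (replicate i Bi @ replicate i B)"
    using nf by (simp add: apow_def)
  then show ?thesis using bs_eq_Bi_B_power bs_eq.trans by blast
qed

section \<open>Inverse words\<close>

definition winv :: "letter list \<Rightarrow> letter list" where
  "winv w = rev (map linv w)"

lemma length_winv [simp]: "length (winv w) = length w"
  by (simp add: winv_def)

lemma bs_eq_winv_left: "bs_eq (winv w @ w) []"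
proof (induction w)
  case (Cons x w)
  have "bs_eq (winv w @ [linv x, linv (linv x)] @ w) (winv w @ w)"
    by (rule bs_eq.cancel)
  moreover have "linv (linv x) = x" by (cases x) auto
  ultimately have "bs_eq (winv (x # w) @ x # w) (winv w @ w)"
    by (simp add: winv_def)
  with Cons show ?case using bs_eq.trans by blast
qed (simp add: winv_def bs_eq.refl)

lemma act_winv_left [simp]: "act (winv w) (act w y) = y"
  using bs_eq_imp_act[OF bs_eq_winv_left[of w]] by (metis act.simps(1) act_append)

lemma winv_winv [simp]: "winv (winv w) = w"
proof -
  have "linv \<circ> linv = id" by (rule ext, rename_tac x, case_tac x) auto
  then show ?thesis by (simp add: winv_def rev_map)
qed

lemma act_winv_right [simp]: "act w (act (winv w) y) = y"
  using act_winv_left[of "winv w" y] by simp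

lemma bs_eq_iff_act: "bs_eq u v \<longleftrightarrow> act u = act v"
proof
  assume eq: "act u = act v"
  have "bs_eq (winv v @ u) []"
    by (rule act_id_imp_bs_eq) (simp add: fun_eq_iff eq)
  then have "bs_eq (v @ winv v @ u) v"
    using bs_eq_append_left[of "winv v @ u" "[]" v] by simp
  moreover have "bs_eq (v @ winv v @ u) u"
    using bs_eq_append_right[OF bs_eq_winv_left[of "winv v"], of u] by simp
  ultimately show "bs_eq u v" by (blast intro: bs_eq.trans bs_eq.sym)
qed (rule bs_eq_imp_act)

section \<open>Cycles without shortcuts\<close>

text \<open>A counterexample to chordality: no subword equals a word strictly shorter than both
  itself and the complementary arc, so the cycle embeds isometrically in the Cayley graph.\<close>

definition isometric_cycle :: "letter list \<Rightarrow> bool" where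
  "isometric_cycle w \<longleftrightarrow> act w = id \<and> 6 \<le> length w \<and>
     (\<forall>x u y v. w = x @ u @ y \<and> act v = act u \<longrightarrow>
        length u \<le> length v \<or> length x + length y \<le> length v)"

lemma isometric_cycleD:
  assumes "isometric_cycle (x @ u @ y)" "act v = act u" "length v < length u"
  shows "length x + length y \<le> length v"
proof -
  have "length u \<le> length v \<or> length x + length y \<le> length v"
    using assms(1,2) unfolding isometric_cycle_def by blast
  with assms(3) show ?thesis by simp
qed

text \<open>A subword of \<open>q @ p\<close> inside \<open>p\<close> or \<open>q\<close> also
  occurs in \<open>p @ q\<close>. If it straddles the junction, its complement \<open>y @ x\<close>
  occurs in \<open>p @ q\<close> instead, and the inverse of the shortcut is a shortcut for that
  complement.\<close>

lemma isometric_cycle_rotate: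
  assumes "isometric_cycle (p @ q)"
  shows "isometric_cycle (q @ p)"
proof -
  have id: "act p (act q y) = y" for y
    using assms by (simp add: isometric_cycle_def fun_eq_iff)
  have id': "act q (act p y) = y" for y
  proof -
    have "act q y = act (winv p) y" for y using id[of y] by (metis act_winv_left)
    then show ?thesis by simp
  qed
  have "length u \<le> length v \<or> length x + length y \<le> length v"
    if split: "q @ p = x @ u @ y" and v: "act v = act u" for x u y v
  proof (rule ccontr)
    assume "\<not> ?thesis"
    then have less: "length v < length u" "length v < length x + length y" by auto
    have no: False if "p @ q = x' @ u @ y'" for x' y'
    proof -
      have "length x' + length y' = length x + length y"
        using arg_cong[OF that, of length] arg_cong[OF split, of length] by simp
      with that v less assms isometric_cycleD[of x' u y' v] show False by simp
    qed
    consider r where "q = x @ u @ r" | u1 u2 where "q = x @ u1" "u = u1 @ u2" "p = u2 @ y"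
      | r where "p = r @ u @ y" "x = q @ r"
      using split by (auto simp: append_eq_append_conv2)
    then show False
    proof cases
      case 1
      then show False using no[of "p @ x" r] by simp
    next
      case 2
      then have w: "p @ q = u2 @ (y @ x) @ u1" by simp
      have "act (winv v) z = act (y @ x) z" for z
      proof -
        have "act u (act (y @ x) z) = z"
        proof -
          have "act x (act u1 (act u2 (act y (act x z)))) = act x z"
            using id'[of "act x z"] 2 by simp
          then show ?thesis using 2 by (metis act_append act_winv_left)
        qed
        then show ?thesis using v by (metis act_winv_left)
      qed
      then have "act (winv v) = act (y @ x)" by blast
      with isometric_cycleD[of u2 "y @ x" u1 "winv v"] w assms less 2 show False
        by simp
    next
      case 3
      then show False using no[of r "y @ q"] by simp
    qed
  qed
  then show ?thesis using assms id' by (simp add: isometric_cycle_def fun_eq_iff)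
qed

section \<open>The sign symmetry and short forbidden subwords\<close>

fun fl :: "letter \<Rightarrow> letter" where
  "fl A = Ai" | "fl Ai = A" | "fl B = B" | "fl Bi = Bi"

lemma fl_fl [simp]: "fl (fl x) = x" "fl \<circ> fl = id"
proof -
  show "fl (fl x) = x" for x by (cases x) auto
  then show "fl \<circ> fl = id" by auto
qed

text \<open>\<open>fl\<close> induces the automorphism fixing b and inverting a; on the line it is
  conjugation by the reflection at 0.\<close>

lemma act_fl [simp]: "act (map fl w) y = - act w (- y)"
  by (induction w y rule: act.induct) auto

lemma isometric_cycle_fl:
  assumes "isometric_cycle w"
  shows "isometric_cycle (map fl w)"
proof -
  have "length u \<le> length v \<or> length x + length y \<le> length v"
    if split: "map fl w = x @ u @ y" and v: "act v = act u" for x u y v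
  proof -
    have "w = map fl (map fl w)" by simp
    also have "\<dots> = map fl x @ map fl u @ map fl y" by (simp only: split map_append)
    finally have w: "w = map fl x @ map fl u @ map fl y" .
    moreover have "act (map fl v) = act (map fl u)" using v by (simp add: fun_eq_iff)
    ultimately show ?thesis using assms unfolding isometric_cycle_def
      by (metis length_map)
  qed
  then show ?thesis using assms by (simp add: isometric_cycle_def fun_eq_iff)
qed

text \<open>Since the cycle has length at least 6, the complement of \<open>u\<close> has at least 3
  letters, so only the comparison with \<open>u\<close> itself matters.\<close>

lemma isometric_cycle_short:
  assumes "isometric_cycle (x @ u @ y)" "length u \<le> 3" "act v = act u"
  shows "length u \<le> length v"
  using assms isometric_cycleD[of x u y v] by (fastforce simp: isometric_cycle_def)


text \<open>Words with a shorter equal: free cancellations and consequences of the relator such as b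
  a b^-1 = a^2, a a b = b a and a^-1 b a = a b.\<close>

definition shortenable :: "letter list set" where
  "shortenable = {[A, Ai], [Ai, A], [B, Bi], [Bi, B], [B, A, Bi], [B, Ai, Bi],
     [A, A, B], [Ai, Ai, B], [Bi, A, A], [Bi, Ai, Ai],
     [Ai, B, A], [A, B, Ai], [A, Bi, Ai], [Ai, Bi, A]}"

lemma not_isometric_cycle_shortenable:
  assumes "u \<in> shortenable"
  shows "\<not> isometric_cycle (x @ u @ y)"
proof -
  have short: "\<not> isometric_cycle (x @ u @ y)"
    if "act v = act u" "length v < length u" "length u \<le> 3" for u v
    using that isometric_cycle_short[of x u y v] by auto
  show ?thesis
    using assms short[of "[]" u] short[of "[A, A]" u] short[of "[Ai, Ai]" u]
      short[of "[B, A]" u] short[of "[B, Ai]" u] short[of "[A, Bi]" u] short[of "[Ai, Bi]" u]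
      short[of "[A, B]" u] short[of "[Ai, B]" u] short[of "[Bi, A]" u] short[of "[Bi, Ai]" u]
    by (auto simp: shortenable_def fun_eq_iff add_divide_distrib diff_divide_distrib)
qed

section \<open>Excursions above a height\<close>

text \<open>Balanced words with b as opening and b^-1 as closing bracket: they return to their
  initial height and never go below it.\<close>

inductive dyck :: "letter list \<Rightarrow> bool" where
  Nil: "dyck []"
| A: "dyck w \<Longrightarrow> dyck (A # w)"
| Ai: "dyck w \<Longrightarrow> dyck (Ai # w)"
| B: "dyck X \<Longrightarrow> dyck w \<Longrightarrow> dyck (B # X @ Bi # w)"

lemma dyck_append: "dyck u \<Longrightarrow> dyck v \<Longrightarrow> dyck (u @ v)"
  by (induction rule: dyck.induct) (auto intro: dyck.intros)

lemma dyck_act: "dyck w \<Longrightarrow> \<exists>m::int. \<forall>y. act w y = y + m"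
proof (induction rule: dyck.induct)
  case Nil
  show ?case by (rule exI[of _ 0]) simp
next
  case (A w)
  then obtain m :: int where "\<forall>y. act w y = y + m" by blast
  then show ?case by (intro exI[of _ "m + 1"]) simp
next
  case (Ai w)
  then obtain m :: int where "\<forall>y. act w y = y + m" by blast
  then show ?case by (intro exI[of _ "m - 1"]) simp
next
  case (B X w)
  then obtain m m' :: int where "\<forall>y. act X y = y + m" "\<forall>y. act w y = y + m'" by blast
  then show ?case by (intro exI[of _ "2 * m + m'"]) simp
qed

text \<open>The counter \<open>n\<close> is the current height; the word must end at height 0
  without going below it.\<close>

fun stays_above :: "nat \<Rightarrow> letter list \<Rightarrow> bool" where
  "stays_above n [] \<longleftrightarrow> n = 0"
| "stays_above n (A # w) \<longleftrightarrow> stays_above n w"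
| "stays_above n (Ai # w) \<longleftrightarrow> stays_above n w"
| "stays_above n (B # w) \<longleftrightarrow> stays_above (Suc n) w"
| "stays_above n (Bi # w) \<longleftrightarrow> (\<exists>m. n = Suc m \<and> stays_above m w)"

text \<open>The second conjunct, which cuts at the first descent below the current height, finds the
  b^-1 matching an opening b. What follows it is a shorter word but not the immediate tail, hence
  the induction on length.\<close>

lemma stays_above_decompose:
  "stays_above n w \<Longrightarrow>
     (n = 0 \<longrightarrow> dyck w) \<and>
     (\<forall>m. n = Suc m \<longrightarrow> (\<exists>X v. w = X @ Bi # v \<and> dyck X \<and> stays_above m v))"
proof (induction "length w" arbitrary: n w rule: less_induct)
  case less
  show ?case
  proof (cases w)
    case Nil
    then show ?thesis using less.prems by (auto intro: dyck.intros)
  next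
    case (Cons x w')
    have IH: "(n = 0 \<longrightarrow> dyck v) \<and>
        (\<forall>m. n = Suc m \<longrightarrow> (\<exists>X u. v = X @ Bi # u \<and> dyck X \<and> stays_above m u))"
      if "stays_above n v" "length v \<le> length w'" for n v
      using less.hyps[of v n] that Cons by auto
    show ?thesis
    proof (cases x)
      case A
      then have IHw: "(n = 0 \<longrightarrow> dyck w') \<and>
        (\<forall>m. n = Suc m \<longrightarrow> (\<exists>X u. w' = X @ Bi # u \<and> dyck X \<and> stays_above m u))"
        using less.prems Cons by (intro IH) auto
      show ?thesis
      proof (intro conjI allI impI)
        assume "n = 0"
        then show "dyck w" using IHw A Cons by (auto intro: dyck.intros)
      next
        fix m assume "n = Suc m"
        with IHw obtain X u where "w' = X @ Bi # u" "dyck X" "stays_above m u" by blast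
        then show "\<exists>X v. w = X @ Bi # v \<and> dyck X \<and> stays_above m v"
          using A Cons by (intro exI[of _ "A # X"] exI[of _ u]) (auto intro: dyck.intros)
      qed
    next
      case Ai
      then have IHw: "(n = 0 \<longrightarrow> dyck w') \<and>
        (\<forall>m. n = Suc m \<longrightarrow> (\<exists>X u. w' = X @ Bi # u \<and> dyck X \<and> stays_above m u))"
        using less.prems Cons by (intro IH) auto
      show ?thesis
      proof (intro conjI allI impI)
        assume "n = 0"
        then show "dyck w" using IHw Ai Cons by (auto intro: dyck.intros)
      next
        fix m assume "n = Suc m"
        with IHw obtain X u where "w' = X @ Bi # u" "dyck X" "stays_above m u" by blast
        then show "\<exists>X v. w = X @ Bi # v \<and> dyck X \<and> stays_above m v"
          using Ai Cons by (intro exI[of _ "Ai # X"] exI[of _ u]) (auto intro: dyck.intros)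
      qed
    next
      case Bi
      then show ?thesis using less.prems Cons
        by (auto intro: dyck.intros exI[of _ "[]"])
    next
      case B
      then have "stays_above (Suc n) w'" using less.prems Cons by simp
      with IH[of "Suc n" w'] obtain X v where
        v: "w' = X @ Bi # v" "dyck X" "stays_above n v" by auto
      have IHv: "(n = 0 \<longrightarrow> dyck v) \<and>
        (\<forall>m. n = Suc m \<longrightarrow> (\<exists>X u. v = X @ Bi # u \<and> dyck X \<and> stays_above m u))"
        using v by (intro IH) auto
      show ?thesis
      proof (intro conjI allI impI)
        assume "n = 0"
        then show "dyck w" using IHv v B Cons by (auto intro: dyck.intros)
      next
        fix m assume "n = Suc m"
        with IHv obtain Y u where "v = Y @ Bi # u" "dyck Y" "stays_above m u" by blast
        then show "\<exists>X v. w = X @ Bi # v \<and> dyck X \<and> stays_above m v"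
          using v B Cons by (intro exI[of _ "B # X @ Bi # Y"] exI[of _ u]) (auto intro: dyck.intros)
      qed
    qed
  qed
qed

section \<open>Heights, and rotation to a lowest point\<close>

fun hgt :: "letter list \<Rightarrow> int" where
  "hgt [] = 0"
| "hgt (A # w) = hgt w"
| "hgt (Ai # w) = hgt w"
| "hgt (B # w) = hgt w + 1"
| "hgt (Bi # w) = hgt w - 1"

lemma hgt_append [simp]: "hgt (u @ v) = hgt u + hgt v"
  by (induction u rule: hgt.induct) auto

lemma act_slope: "act w y - act w 0 = 2 powi hgt w * y"
proof (induction w)
  case (Cons x w)
  then show ?case by (cases x) (auto simp: power_int_add power_int_diff field_simps)
qed simp

lemma hgt_eq_0:
  assumes "act w = id"
  shows "hgt w = 0"
proof -
  have "(2::real) powi hgt w = 2 powi 0" using act_slope[of w 1] assms by simp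
  then show ?thesis
    using power_int_strict_increasing[of "hgt w" 0 "2::real"]
      power_int_strict_increasing[of 0 "hgt w" "2::real"] by (cases "hgt w" "0::int" rule: linorder_cases) auto
qed

lemma stays_aboveI:
  assumes "\<And>u v. w = u @ v \<Longrightarrow> 0 \<le> int n + hgt u" "int n + hgt w = 0"
  shows "stays_above n w"
  using assms
proof (induction w arbitrary: n)
  case (Cons x w)
  have pre: "0 \<le> int n + hgt (x # u)" if "w = u @ v" for u v
    using Cons.prems(1)[of "x # u" v] that by simp
  show ?case
  proof (cases x)
    case B
    then show ?thesis using Cons.IH[of "Suc n"] pre Cons.prems(2) by (simp add: algebra_simps)
  next
    case Bi
    have "n \<noteq> 0" using pre[of "[]" w] Bi by simp
    then obtain m where "n = Suc m" using not0_implies_Suc by blast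
    then show ?thesis using Cons.IH[of m] pre Cons.prems(2) Bi by (simp add: algebra_simps)
  qed (use Cons.IH[of n] pre Cons.prems(2) in auto)
qed simp

text \<open>Cut where the prefix height is minimal. A prefix that wraps around has height
  \<open>hgt q + hgt r = hgt r - hgt p\<close>, which is nonnegative by minimality.\<close>

lemma dyck_rotation:
  assumes "hgt w = 0"
  shows "\<exists>p q. w = p @ q \<and> dyck (q @ p)"
proof -
  define H where "H = (\<lambda>i. hgt (take i w)) ` {..length w}"
  have "finite H" "H \<noteq> {}" by (auto simp: H_def)
  then obtain x where x: "x \<in> H" "\<And>y. y \<in> H \<Longrightarrow> x \<le> y" using Min_in Min_le by blast
  from x(1) obtain i where i: "x = hgt (take i w)" by (auto simp: H_def)
  have min: "hgt (take i w) \<le> hgt u" if "w = u @ v" for u v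
  proof -
    have "hgt u \<in> H" unfolding H_def using that by (auto intro!: image_eqI[of _ _ "length u"])
    with x(2) i show ?thesis by simp
  qed
  define p q where "p = take i w" and "q = drop i w"
  have w: "w = p @ q" by (simp add: p_def q_def)
  have min': "hgt p \<le> hgt u" if "p @ q = u @ v" for u v
  proof -
    have "w = u @ v" using that w by simp
    from min[OF this] show ?thesis by (simp add: p_def)
  qed
  have pq: "hgt p + hgt q = 0" using assms w by simp
  have "stays_above 0 (q @ p)"
  proof (rule stays_aboveI)
    fix u v assume uv: "q @ p = u @ v"
    then consider r where "q = u @ r" | r where "u = q @ r" "p = r @ v"
      by (auto simp: append_eq_append_conv2)
    then show "0 \<le> int 0 + hgt u"
    proof cases
      case 1
      then show ?thesis using min'[of "p @ u" r] by simp
    next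
      case 2
      then show ?thesis using min'[of r "v @ q"] pq by simp
    qed
  qed (use pq in auto)
  then show ?thesis using stays_above_decompose[of 0 "q @ p"] w by auto
qed

text \<open>Opposite horizontal letters cancel, and a a b = b a shortens two equal ones before an
  ascent; so at most one horizontal letter precedes the first ascent, if there is any.\<close>

lemma isometric_cycle_dyck_cases:
  assumes "dyck X" "isometric_cycle (p @ X @ q)"
  shows "(\<exists>k. X = replicate k A \<or> X = replicate k Ai) \<or>
    (\<exists>s Y v. s \<in> {[], [A], [Ai]} \<and> X = s @ B # Y @ Bi # v \<and> dyck Y \<and> dyck v)"
  using assms
proof (induction arbitrary: p rule: dyck.induct)
  case Nil
  show ?case by (auto intro: exI[of _ 0])
next
  case (A w)
  note no = not_isometric_cycle_shortenable
  from A.prems have cyc: "isometric_cycle ((p @ [A]) @ w @ q)" by simp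
  from A.IH[OF this] show ?case
  proof (elim disjE exE conjE)
    fix k assume "w = replicate k A"
    then show ?thesis by (auto intro!: exI[of _ "Suc k"])
  next
    fix k assume w: "w = replicate k Ai"
    show ?thesis
    proof (cases k)
      case 0
      then show ?thesis using w by (auto intro!: exI[of _ 1])
    next
      case (Suc j)
      then show ?thesis using w cyc no[of "[A, Ai]" p "replicate j Ai @ q"]
        by (simp add: shortenable_def)
    qed
  next
    fix s Y v assume *: "s \<in> {[], [A], [Ai]}" "w = s @ B # Y @ Bi # v" "dyck Y" "dyck v"
    then have "s = []"
      using cyc no[of "[A, A, B]" p "Y @ Bi # v @ q"] no[of "[A, Ai]" p "B # Y @ Bi # v @ q"]
      by (auto simp: shortenable_def)
    then show ?thesis using * by (intro disjI2 exI[of _ "[A]"] exI[of _ Y] exI[of _ v]) auto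
  qed
next
  case (Ai w)
  note no = not_isometric_cycle_shortenable
  from Ai.prems have cyc: "isometric_cycle ((p @ [Ai]) @ w @ q)" by simp
  from Ai.IH[OF this] show ?case
  proof (elim disjE exE conjE)
    fix k assume "w = replicate k Ai"
    then show ?thesis by (auto intro!: exI[of _ "Suc k"])
  next
    fix k assume w: "w = replicate k A"
    show ?thesis
    proof (cases k)
      case 0
      then show ?thesis using w by (auto intro!: exI[of _ 1])
    next
      case (Suc j)
      then show ?thesis using w cyc no[of "[Ai, A]" p "replicate j A @ q"]
        by (simp add: shortenable_def)
    qed
  next
    fix s Y v assume *: "s \<in> {[], [A], [Ai]}" "w = s @ B # Y @ Bi # v" "dyck Y" "dyck v"
    then have "s = []"
      using cyc no[of "[Ai, Ai, B]" p "Y @ Bi # v @ q"] no[of "[Ai, A]" p "B # Y @ Bi # v @ q"]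
      by (auto simp: shortenable_def)
    then show ?thesis using * by (intro disjI2 exI[of _ "[Ai]"] exI[of _ Y] exI[of _ v]) auto
  qed
next
  case (B X w)
  then show ?case by (intro disjI2 exI[of _ "[]"] exI[of _ X] exI[of _ w]) auto
qed

text \<open>As b^-1 a a = a b^-1, at most one horizontal letter follows the descent before the next
  ascent or the end of \<open>w\<close>; before an ascent there is exactly one, as b^-1 b would
  cancel.\<close>

lemma isometric_cycle_after_descent:
  assumes "dyck w" "isometric_cycle (p @ Bi # w @ q)"
  shows "w = [] \<or> (\<exists>s\<in>{A, Ai}. w = [s] \<or>
    (\<exists>Y v. w = s # B # Y @ Bi # v \<and> dyck Y \<and> dyck v))"
proof -
  note no = not_isometric_cycle_shortenable
  from assms(2) have "isometric_cycle ((p @ [Bi]) @ w @ q)" by simp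
  from isometric_cycle_dyck_cases[OF assms(1) this] show ?thesis
  proof (elim disjE exE conjE)
    fix k assume w: "w = replicate k A"
    have "\<not> 2 \<le> k"
    proof
      assume "2 \<le> k"
      then obtain j where "k = Suc (Suc j)" by (metis add_2_eq_Suc le_Suc_ex)
      then show False using w assms(2) no[of "[Bi, A, A]" p "replicate j A @ q"]
        by (simp add: shortenable_def)
    qed
    then have "k = 0 \<or> k = 1" by auto
    then show ?thesis using w by auto
  next
    fix k assume w: "w = replicate k Ai"
    have "\<not> 2 \<le> k"
    proof
      assume "2 \<le> k"
      then obtain j where "k = Suc (Suc j)" by (metis add_2_eq_Suc le_Suc_ex)
      then show False using w assms(2) no[of "[Bi, Ai, Ai]" p "replicate j Ai @ q"]
        by (simp add: shortenable_def)
    qed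
    then have "k = 0 \<or> k = 1" by auto
    then show ?thesis using w by auto
  next
    fix s Y v assume *: "s \<in> {[], [A], [Ai]}" "w = s @ B # Y @ Bi # v" "dyck Y" "dyck v"
    then have "s \<noteq> []"
      using assms(2) no[of "[Bi, B]" p "Y @ Bi # v @ q"] by (auto simp: shortenable_def)
    with * show ?thesis by auto
  qed
qed

text \<open>Excursions represent powers of \<open>a\<close>, so they commute with \<open>a\<close>; moving the letter \<open>s\<close>
  out of the way cancels a pair \<open>b\<^sup>-\<^sup>1 b\<close>.\<close>
lemma isometric_cycle_adjacent_excursions:
  assumes "isometric_cycle (p @ (B # X @ Bi # s # B # Y @ [Bi]) @ q)" "dyck X" "dyck Y" "s \<in> {A, Ai}"
  shows "length p + length q \<le> length X + length Y + 3"
proof -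
  obtain m m' :: int where "\<forall>y. act X y = y + m" "\<forall>y. act Y y = y + m'"
    using dyck_act assms(2,3) by blast
  then have "act (s # B # X @ Y @ [Bi]) = act (B # X @ Bi # s # B # Y @ [Bi])"
    using assms(4) by (auto simp: fun_eq_iff)
  from isometric_cycleD[OF assms(1) this] show ?thesis by simp
qed

section \<open>Mountains\<close>

text \<open>The mountain itself is the word \<open>P a\<^sup>k Q\<close> with its only peak at \<open>a\<^sup>k\<close>, at height \<open>h\<close>. The
  restrictions on \<open>k\<close>, \<open>s\<close> and \<open>t\<close> are those forced by shortcuts of segments of length at most 3.\<close>
inductive mountain :: "nat \<Rightarrow> nat \<Rightarrow> letter list \<Rightarrow> letter list \<Rightarrow> bool" where
  peak: "2 \<le> k \<Longrightarrow> mountain 1 k [B] [Bi]"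
| lower: "mountain h k P Q \<Longrightarrow> s \<in> {[], [A], [Ai]} \<Longrightarrow> t \<in> {[], [A], [Ai]} \<Longrightarrow>
    (h = 1 \<Longrightarrow> s \<noteq> [Ai] \<and> t \<noteq> [Ai]) \<Longrightarrow> mountain (Suc h) k (B # s @ P) (Q @ t @ [Bi])"

lemma mountain_pos: "mountain h k P Q \<Longrightarrow> 1 \<le> h \<and> 2 \<le> k"
  by (induction rule: mountain.induct) auto

lemma mountain_height_1: "mountain 1 k P Q \<Longrightarrow> P = [B] \<and> Q = [Bi]"
  by (erule mountain.cases) (auto dest: mountain_pos)

lemma mountain_ends: "mountain h k P Q \<Longrightarrow> (\<exists>P'. P = P' @ [B]) \<and> (\<exists>Q'. Q = Bi # Q')"
  by (induction rule: mountain.induct) auto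

lemma act_horizontal_step:
  assumes "s \<in> {[], [A], [Ai]}"
  obtains \<sigma> where "\<And>y. act s y = y + \<sigma>" "\<bar>\<sigma>\<bar> \<le> 1" "s \<noteq> [Ai] \<Longrightarrow> 0 \<le> \<sigma>"
  using assms that[of 0] that[of 1] that[of "-1"] by auto

lemma mountain_act:
  assumes "mountain h k P Q"
  obtains p q where "\<And>y. act P y = 2 ^ h * y + p" "\<And>y. act Q y = y / 2 ^ h + q"
proof -
  from assms have "\<exists>p q. (\<forall>y. act P y = 2 ^ h * y + p) \<and> (\<forall>y. act Q y = y / 2 ^ h + q)"
  proof (induction rule: mountain.induct)
    case (peak k)
    show ?case by (rule exI[of _ 0], rule exI[of _ 0]) simp
  next
    case (lower h k P Q s t)
    then obtain p q where pq: "\<forall>y. act P y = 2 ^ h * y + p" "\<forall>y. act Q y = y / 2 ^ h + q"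
      by blast
    obtain \<sigma> where \<sigma>: "\<And>y. act s y = y + \<sigma>" using act_horizontal_step lower.hyps(2) by blast
    obtain \<tau> where \<tau>: "\<And>y. act t y = y + \<tau>" using act_horizontal_step lower.hyps(3) by blast
    have "(\<forall>y. act (B # s @ P) y = 2 ^ Suc h * y + 2 * (p + \<sigma>)) \<and>
      (\<forall>y. act (Q @ t @ [Bi]) y = y / 2 ^ Suc h + (\<tau> / 2 ^ h + q))"
      by (simp add: pq \<sigma> \<tau> algebra_simps add_divide_distrib)
    then show ?case by blast
  qed
  then show ?thesis using that by blast
qed

text \<open>Each new level turns m into 2 (m + \<sigma> + \<tau>) with horizontal steps of size at
  most 1. The constant 4 is the fixed point of c -> 2 (c - 2), so all bounds survive the induction.
  The bound \<open>2 ^ h + 4\<close> starts only at height 2, where \<sigma> and \<tau> are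
  nonnegative.\<close>

lemma mountain_value:
  assumes "mountain h k P Q"
  obtains m where "\<And>y. act (P @ replicate k A @ Q) y = y + m" "4 \<le> m"
    "2 \<le> h \<Longrightarrow> 2 ^ h + 4 \<le> m" "m \<le> 2 ^ h * (real k + 2) - 4"
proof -
  from assms have "\<exists>m. (\<forall>y. act (P @ replicate k A @ Q) y = y + m) \<and> 4 \<le> m \<and>
     (2 \<le> h \<longrightarrow> 2 ^ h + 4 \<le> m) \<and> m \<le> 2 ^ h * (real k + 2) - 4"
  proof (induction rule: mountain.induct)
    case (peak k)
    then show ?case by (intro exI[of _ "2 * real k"]) (auto simp: field_simps)
  next
    case (lower h k P Q s t)
    then obtain m where m: "\<forall>y. act (P @ replicate k A @ Q) y = y + m" "4 \<le> m"
       "2 \<le> h \<longrightarrow> 2 ^ h + 4 \<le> m" "m \<le> 2 ^ h * (real k + 2) - 4" by blast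
    obtain \<sigma> where \<sigma>: "\<And>y. act s y = y + \<sigma>" "\<bar>\<sigma>\<bar> \<le> 1" "s \<noteq> [Ai] \<Longrightarrow> 0 \<le> \<sigma>"
      using act_horizontal_step lower.hyps(2) by blast
    obtain \<tau> where \<tau>: "\<And>y. act t y = y + \<tau>" "\<bar>\<tau>\<bar> \<le> 1" "t \<noteq> [Ai] \<Longrightarrow> 0 \<le> \<tau>"
      using act_horizontal_step lower.hyps(3) by blast
    have act: "\<forall>y. act ((B # s @ P) @ replicate k A @ (Q @ t @ [Bi])) y = y + 2 * (m + \<sigma> + \<tau>)"
      using m(1) by (simp add: \<sigma>(1) \<tau>(1) algebra_simps)
    have "2 ^ Suc h + 4 \<le> 2 * (m + \<sigma> + \<tau>)"
    proof (cases "h = 1")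
      case True
      then show ?thesis using m(2) \<sigma>(3) \<tau>(3) lower.hyps(4) by auto
    next
      case False
      then have "2 \<le> h" using mountain_pos[OF lower.hyps(1)] by auto
      with m(3) have "2 ^ h + 4 \<le> m" by blast
      with \<sigma>(2) \<tau>(2) show ?thesis by (auto simp: abs_le_iff)
    qed
    moreover have "2 * (m + \<sigma> + \<tau>) \<le> 2 ^ Suc h * (real k + 2) - 4"
      using m(4) \<sigma>(2) \<tau>(2) by (auto simp: abs_le_iff algebra_simps)
    moreover have "4 \<le> 2 * (m + \<sigma> + \<tau>)" using m(2) \<sigma>(2) \<tau>(2) by (auto simp: abs_le_iff)
    ultimately show ?case using act by blast
  qed
  then show ?thesis using that by blast
qed

text \<open>One level below a peak of height 1, letters of the sign opposite to the peak are
  excluded by a^-1 b a = a b and a b^-1 a^-1 = b^-1 a.\<close>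

lemma isometric_cycle_mountain_lower:
  assumes "mountain h k P Q" "isometric_cycle (p @ B # s @ P @ replicate k A @ Q @ t @ Bi # q)"
    "s \<in> {[], [A], [Ai]}" "t \<in> {[], [A], [Ai]}"
  shows "mountain (Suc h) k (B # s @ P) (Q @ t @ [Bi])"
proof (rule mountain.lower[OF assms(1,3,4)])
  assume "h = 1"
  then have PQ: "P = [B]" "Q = [Bi]" using mountain_height_1 assms(1) by auto
  obtain j where "k = Suc j" using mountain_pos[OF assms(1)] by (cases k) auto
  then have k: "replicate k A = A # replicate j A" "replicate k A = replicate j A @ [A]"
    by (simp_all add: replicate_append_same)
  note no = not_isometric_cycle_shortenable
  have "s \<noteq> [Ai]"
    using no[of "[Ai, B, A]" "p @ [B]" "replicate j A @ Q @ t @ Bi # q"] assms(2) PQ(1) k(1)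
    by (auto simp: shortenable_def)
  moreover have "t \<noteq> [Ai]"
    using no[of "[A, Bi, Ai]" "p @ B # s @ P @ replicate j A" "Bi # q"] assms(2) PQ(2) k(2)
    by (auto simp: shortenable_def)
  ultimately show "s \<noteq> [Ai] \<and> t \<noteq> [Ai]" by blast
qed

text \<open>The length bound makes the rest of the cycle too long for two adjacent excursions inside
  \<open>X\<close>. So each level holds a single excursion, and the induction peels off levels down
  to the peak; a negative peak is treated by flipping the cycle.\<close>

lemma isometric_cycle_mountain:
  assumes "isometric_cycle (p @ B # X @ Bi # q)" "dyck X" "length X < length p + length q + 4"
  shows "\<exists>h k P Q. mountain h k P Q \<and>
    (B # X @ [Bi] = P @ replicate k A @ Q \<or> B # X @ [Bi] = map fl (P @ replicate k A @ Q))"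
  using assms
proof (induction "length X" arbitrary: X p q rule: less_induct)
  case less
  note no = not_isometric_cycle_shortenable
  from less.prems(1) have "isometric_cycle ((p @ [B]) @ X @ (Bi # q))" by simp
  from isometric_cycle_dyck_cases[OF less.prems(2) this] show ?case
  proof (elim disjE exE conjE)
    fix k assume X: "X = replicate k A"
    have "k \<noteq> 0"
      using X less.prems(1) no[of "[B, Bi]" p q] by (intro notI) (simp add: shortenable_def)
    moreover have "k \<noteq> 1"
      using X less.prems(1) no[of "[B, A, Bi]" p q] by (intro notI) (simp add: shortenable_def)
    ultimately have "2 \<le> k" by simp
    then show ?thesis using X mountain.peak[of k] by fastforce
  next
    fix k assume X: "X = replicate k Ai"
    have "k \<noteq> 0"
      using X less.prems(1) no[of "[B, Bi]" p q] by (intro notI) (simp add: shortenable_def)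
    moreover have "k \<noteq> 1"
      using X less.prems(1) no[of "[B, Ai, Bi]" p q] by (intro notI) (simp add: shortenable_def)
    ultimately have "2 \<le> k" by simp
    then have "mountain 1 k [B] [Bi]" by (rule mountain.peak)
    moreover have "B # X @ [Bi] = map fl ([B] @ replicate k A @ [Bi])" using X by simp
    ultimately show ?thesis by metis
  next
    fix s Y v assume X: "s \<in> {[], [A], [Ai]}" "X = s @ B # Y @ Bi # v" "dyck Y" "dyck v"
    have "isometric_cycle ((p @ B # s @ B # Y) @ Bi # v @ (Bi # q))"
      using less.prems(1) X(2) by simp
    from isometric_cycle_after_descent[OF X(4) this]
    have v: "v \<in> {[], [A], [Ai]}"
    proof (elim disjE bexE exE conjE)
      fix t Z u assume *: "t \<in> {A, Ai}" "v = t # B # Z @ Bi # u" "dyck Z"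
      have "isometric_cycle ((p @ B # s) @ (B # Y @ Bi # t # B # Z @ [Bi]) @ (u @ Bi # q))"
        using less.prems(1) X(2) * by simp
      from isometric_cycle_adjacent_excursions[OF this X(3) *(3,1)] less.prems(3) X(2) *(2)
      show ?thesis by simp
    qed auto
    have "isometric_cycle ((p @ B # s) @ B # Y @ Bi # (v @ Bi # q))"
      using less.prems(1) X(2) by simp
    from less.hyps[OF _ this X(3)] X(2) less.prems(3) obtain h k P Q where
      M: "mountain h k P Q" and
      or: "B # Y @ [Bi] = P @ replicate k A @ Q \<or> B # Y @ [Bi] = map fl (P @ replicate k A @ Q)"
      by auto
    have BX: "B # X @ [Bi] = B # s @ (B # Y @ [Bi]) @ v @ [Bi]" using X(2) by simp
    have cyc: "isometric_cycle (p @ B # s @ (B # Y @ [Bi]) @ v @ Bi # q)"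
      using less.prems(1) X(2) by simp
    from or show ?thesis
    proof
      assume Y: "B # Y @ [Bi] = P @ replicate k A @ Q"
      have "isometric_cycle (p @ B # s @ P @ replicate k A @ Q @ v @ Bi # q)"
        using cyc unfolding Y by simp
      from isometric_cycle_mountain_lower[OF M this X(1) v]
      show ?thesis unfolding BX Y by fastforce
    next
      assume Y: "B # Y @ [Bi] = map fl (P @ replicate k A @ Q)"
      have "isometric_cycle (map fl p @ B # map fl s @ P @ replicate k A @ Q @ map fl v @ Bi # map fl q)"
        using isometric_cycle_fl[OF cyc] unfolding Y by (simp add: o_def)
      from isometric_cycle_mountain_lower[OF M this] X(1) v
      have "mountain (Suc h) k (B # map fl s @ P) (Q @ map fl v @ [Bi])" by auto
      moreover have "B # X @ [Bi] =
          map fl ((B # map fl s @ P) @ replicate k A @ (Q @ map fl v @ [Bi]))"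
        unfolding BX Y by (simp add: o_def)
      ultimately show ?thesis by metis
    qed
  qed
qed


section \<open>Two opposite mountains\<close>

text \<open>Both segments joining the peaks can be shortened, so each must have a complement no
  longer than its replacement. Adding the two inequalities cancels the slopes and leaves only the
  peak letters outside the segments.\<close>

lemma no_isometric_cycle_opposite_mountains_le:
  assumes cyc: "isometric_cycle (P @ replicate k A @ Q @ [e] @
      map fl P' @ replicate l Ai @ map fl Q' @ [f])"
    and M: "mountain h k P Q" and M': "mountain h' l P' Q'" and "h' \<le> h"
    and e: "e \<in> {A, Ai}" and f: "f \<in> {A, Ai}"
  shows False
proof -
  obtain p q where p: "\<And>y. act P y = 2 ^ h * y + p" and q: "\<And>y. act Q y = y / 2 ^ h + q"
    using mountain_act[OF M] by blast
  obtain p' q' where p': "\<And>y. act P' y = 2 ^ h' * y + p'" and q': "\<And>y. act Q' y = y / 2 ^ h' + q'"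
    using mountain_act[OF M'] by blast
  obtain \<epsilon> :: real where \<epsilon>: "\<And>w y. act (e # w) y = act w y + \<epsilon>" "\<bar>\<epsilon>\<bar> \<le> 1"
    using e that[of 1] that[of "-1"] by auto
  obtain \<phi> :: real where \<phi>: "\<And>w y. act (f # w) y = act w y + \<phi>" "\<bar>\<phi>\<bar> \<le> 1"
    using f that[of 1] that[of "-1"] by auto
  have k: "2 \<le> k" and l: "2 \<le> l" using mountain_pos M M' by auto
  obtain i where i: "k = Suc i" using k by (cases k) auto
  have cyc': "isometric_cycle (map fl P' @ replicate l Ai @ map fl Q' @ [f] @
      P @ replicate k A @ Q @ [e])"
    using isometric_cycle_rotate[of "P @ replicate k A @ Q @ [e]"
        "map fl P' @ replicate l Ai @ map fl Q' @ [f]"] cyc by simp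
  show False
  proof (cases "h = h'")
    case True
    \<comment> \<open>At equal heights the path between the peaks acts as a translation, hence
      commutes with a, and the a and a^-1 at its ends cancel. The sum of the two inequalities is i +
      j \<le> 0, against k \<ge> 2.\<close>
    obtain j where j: "l = Suc j" using l by (cases l) auto
    have "isometric_cycle ((P @ replicate i A) @ ([A] @ Q @ [e] @ map fl P' @ [Ai]) @
        (replicate j Ai @ map fl Q' @ [f]))"
      using cyc i j by (simp add: replicate_app_Cons_same)
    moreover have "act (Q @ [e] @ map fl P') = act ([A] @ Q @ [e] @ map fl P' @ [Ai])"
      using True by (simp add: fun_eq_iff q p' \<epsilon>(1) field_simps)
    ultimately have 1: "length P + i + j + length Q' \<le> length Q + length P'"
      using isometric_cycleD by fastforce
    have "isometric_cycle ((map fl P' @ replicate j Ai) @ ([Ai] @ map fl Q' @ [f] @ P @ [A]) @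
        (replicate i A @ Q @ [e]))"
      using cyc' i j by (simp add: replicate_app_Cons_same)
    moreover have "act (map fl Q' @ [f] @ P) = act ([Ai] @ map fl Q' @ [f] @ P @ [A])"
      using True by (simp add: fun_eq_iff q' p \<phi>(1) field_simps)
    ultimately have 2: "length P' + j + i + length Q \<le> length Q' + length P"
      using isometric_cycleD by fastforce
    from 1 2 i k show False by simp
  next
    case False
    txt \<open>Removing \<open>a\<close> at height \<open>h\<close> together with \<open>a\<^sup>-\<^sup>c\<close> at height \<open>h'\<close> is compensated by a single
      \<open>a\<close> at height \<open>h - 1\<close>; this applies on both sides of the two peaks.\<close>
    define c :: nat where "c = 2 ^ (h - h' - 1)"
    have "h = h' + Suc (h - h' - 1)" using False \<open>h' \<le> h\<close> by simp
    then have h: "(2::real) ^ h = 2 * c * 2 ^ h'" unfolding c_def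
      by (metis power_add power_Suc mult.commute mult.assoc of_nat_numeral of_nat_power)
    have c: "1 \<le> c" by (simp add: c_def)
    \<comment> \<open>The values of the two mountains differ by at most 2, the contribution of
      \<open>e\<close> and \<open>f\<close>; the bounds of \<open>mountain_value\<close> then give
      2^h < 2^h' (l + 2). So the lower peak has \<open>c\<close> letters to remove.\<close>
    have "2 * c < l + 2"
    proof -
      obtain m where m: "\<And>y. act (P @ replicate k A @ Q) y = y + m" "2 \<le> h \<Longrightarrow> 2 ^ h + 4 \<le> m"
        using mountain_value[OF M] by blast
      obtain m' where m': "\<And>y. act (P' @ replicate l A @ Q') y = y + m'"
        "m' \<le> 2 ^ h' * (real l + 2) - 4"
        using mountain_value[OF M'] by blast
      have "act P (act Q y + k) = y + m" "act P' (l + act Q' y) = y + m'" for y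
        using m(1)[of y] m'(1)[of y] by (simp_all add: add.commute)
      moreover have "act (P @ replicate k A @ Q @ [e] @ map fl P' @ replicate l Ai @
          map fl Q' @ [f]) 0 = 0"
        using cyc by (simp add: isometric_cycle_def)
      ultimately have "m + \<epsilon> - m' + \<phi> = 0"
        by (simp add: \<epsilon>(1) \<phi>(1))
      moreover have "2 \<le> h" using False \<open>h' \<le> h\<close> mountain_pos[OF M'] by simp
      ultimately have "2 ^ h' * real (2 * c) < 2 ^ h' * real (l + 2)"
        using m(2) m'(2) \<epsilon>(2) \<phi>(2) h by (simp add: abs_le_iff algebra_simps)
      then show ?thesis by (simp only: mult_less_cancel_left_pos zero_less_power zero_less_numeral of_nat_less_iff)
    qed
    then have "c \<le> l" using c by simp
    then obtain j where j: "l = c + j" using le_Suc_ex by blast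
    \<comment> \<open>Splitting off the letter next to the peak gives access to height h - 1, where
      the compensating a is inserted.\<close>
    obtain P0 where P0: "P = P0 @ [B]" using mountain_ends[OF M] by blast
    obtain Q0 where Q0: "Q = Bi # Q0" using mountain_ends[OF M] by blast
    have actP0: "act P0 z = real c * 2 ^ h' * z + p" for z using p[of "z / 2"] P0 h by simp
    have actQ0: "act Q0 z = z / (real c * 2 ^ h') + 2 * q" for z using q[of z] Q0 h by simp
    have "isometric_cycle ((P @ replicate i A) @ ([A] @ Q @ [e] @ map fl P' @ replicate c Ai) @
        (replicate j Ai @ map fl Q' @ [f]))"
      using cyc i j by (simp add: replicate_app_Cons_same replicate_add)
    moreover have "act (Bi # A # Q0 @ [e] @ map fl P') =
        act ([A] @ Q @ [e] @ map fl P' @ replicate c Ai)"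
      using c by (simp add: fun_eq_iff Q0 actQ0 p' \<epsilon>(1) field_simps)
    ultimately have 1: "length P + i + j + length Q' \<le> length Q + length P' + 1"
      using isometric_cycleD[of "P @ replicate i A" "[A] @ Q @ [e] @ map fl P' @ replicate c Ai"
          "replicate j Ai @ map fl Q' @ [f]" "Bi # A # Q0 @ [e] @ map fl P'"] c Q0 by simp
    have "isometric_cycle ((map fl P' @ replicate j Ai) @
        (replicate c Ai @ map fl Q' @ [f] @ P @ [A]) @ (replicate i A @ Q @ [e]))"
      using cyc' i j by (simp add: add.commute[of c] replicate_add)
    moreover have "act (map fl Q' @ [f] @ P0 @ [A, B]) =
        act (replicate c Ai @ map fl Q' @ [f] @ P @ [A])"
      using c by (simp add: fun_eq_iff P0 actP0 q' \<phi>(1) field_simps)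
    ultimately have 2: "length P' + j + i + length Q \<le> length Q' + length P + 1"
      using isometric_cycleD[of "map fl P' @ replicate j Ai"
          "replicate c Ai @ map fl Q' @ [f] @ P @ [A]"
          "replicate i A @ Q @ [e]" "map fl Q' @ [f] @ P0 @ [A, B]"] c P0 by simp
    \<comment> \<open>The sum is i + j \<le> 1 with i \<ge> 1. Hence l = c, and 2 c < l + 2
      contradicts l \<ge> 2.\<close>
    from 1 2 i k have "j = 0" by simp
    then show False using j l \<open>2 * c < l + 2\<close> by simp
  qed
qed

text \<open>Rotating by half the cycle and flipping signs exchanges the mountains, so the first may
  be taken as the higher one.\<close>

lemma no_isometric_cycle_opposite_mountains:
  assumes cyc: "isometric_cycle ((P @ replicate k A @ Q) @ [e] @
      map fl (P' @ replicate l A @ Q') @ [f])"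
    and M: "mountain h k P Q" and M': "mountain h' l P' Q'"
    and e: "e \<in> {A, Ai}" and f: "f \<in> {A, Ai}"
  shows False
proof (cases "h' \<le> h")
  case True
  show False
    by (rule no_isometric_cycle_opposite_mountains_le[OF _ M M' True e f]) (use cyc in simp)
next
  case False
  have "isometric_cycle (map fl ((map fl (P' @ replicate l A @ Q') @ [f]) @
      ((P @ replicate k A @ Q) @ [e])))"
    by (rule isometric_cycle_fl, rule isometric_cycle_rotate) (use cyc in simp)
  then have "isometric_cycle (P' @ replicate l A @ Q' @ [fl f] @
      map fl P @ replicate k Ai @ map fl Q @ [fl e])"
    by (simp add: o_def)
  from no_isometric_cycle_opposite_mountains_le[OF this M' M] False e f show False by auto
qed

text \<open>Closing up gives 2 (m + m') = 0 or \<plusminus>2, so \<open>X\<close> equals the inverse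
  of \<open>Y\<close> times at most one letter. The complement of \<open>X\<close> is longer than
  this word, which therefore cannot be shorter than \<open>X\<close>.\<close>

lemma isometric_cycle_two_excursions_length:
  assumes "isometric_cycle (B # X @ Bi # e # B # Y @ [Bi, f])" "dyck X" "dyck Y"
    "e \<in> {A, Ai}" "f \<in> {A, Ai}"
  shows "length X \<le> length Y + 1"
proof -
  obtain m m' :: int where m: "\<And>y. act X y = y + m" and m': "\<And>y. act Y y = y + m'"
    using dyck_act assms(2,3) by metis
  have "act (B # X @ Bi # e # B # Y @ [Bi, f]) 0 = 0"
    using assms(1) by (simp add: isometric_cycle_def)
  moreover have "act (winv Y) y = y - m'" for y
    using act_winv_left[of Y "y - m'"] m' by simp
  ultimately obtain s where "act (winv Y @ s) = act X" "length s \<le> 1"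
    using assms(4,5) that[of "[]"] that[of "[A]"] that[of "[Ai]"]
    by (auto simp: fun_eq_iff m m')
  moreover have "isometric_cycle ([B] @ X @ (Bi # e # B # Y @ [Bi, f]))" using assms(1) by simp
  ultimately show ?thesis
    using isometric_cycleD[of "[B]" X "Bi # e # B # Y @ [Bi, f]" "winv Y @ s"] by fastforce
qed

text \<open>Nearly equal lengths make both excursions mountains. Equal signs are impossible, as each
  value has size at least 4 while \<open>e\<close> and \<open>f\<close> contribute at most 2;
  opposite signs were excluded above.\<close>

lemma no_isometric_cycle_two_excursions:
  assumes cyc: "isometric_cycle (B # X @ Bi # e # B # Y @ [Bi, f])" and "dyck X" "dyck Y"
    and e: "e \<in> {A, Ai}" and f: "f \<in> {A, Ai}"
  shows False
proof -
  have cyc': "isometric_cycle (B # Y @ Bi # f # B # X @ [Bi, e])"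
    using isometric_cycle_rotate[of "B # X @ [Bi, e]" "B # Y @ [Bi, f]"] cyc by simp
  have "length X \<le> length Y + 1" "length Y \<le> length X + 1"
    using isometric_cycle_two_excursions_length cyc cyc' assms(2-) by blast+
  then obtain h k P Q h' l P' Q' where
    M: "mountain h k P Q" and
    X: "B # X @ [Bi] = P @ replicate k A @ Q \<or> B # X @ [Bi] = map fl (P @ replicate k A @ Q)" and
    M': "mountain h' l P' Q'" and
    Y: "B # Y @ [Bi] = P' @ replicate l A @ Q' \<or> B # Y @ [Bi] = map fl (P' @ replicate l A @ Q')"
    using isometric_cycle_mountain[of "[]" X "e # B # Y @ [Bi, f]"] cyc
      isometric_cycle_mountain[of "[]" Y "f # B # X @ [Bi, e]"] cyc' assms(2,3) by auto
  let ?U = "P @ replicate k A @ Q" and ?V = "P' @ replicate l A @ Q'"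
  have w: "isometric_cycle ((B # X @ [Bi]) @ [e] @ (B # Y @ [Bi]) @ [f])" using cyc by simp
  have closed: "act (B # X @ [Bi]) (act [e] (act (B # Y @ [Bi]) (act [f] 0))) = 0"
    using w unfolding isometric_cycle_def by (metis act_append id_apply)
  obtain m where m: "\<And>y. act ?U y = y + m" "4 \<le> m" using mountain_value[OF M] by blast
  obtain m' where m': "\<And>y. act ?V y = y + m'" "4 \<le> m'" using mountain_value[OF M'] by blast
  from X Y show False
  proof (elim disjE)
    assume U: "B # X @ [Bi] = ?U" and V: "B # Y @ [Bi] = ?V"
    have "act [e] (act [f] 0 + m') + m = 0" using closed by (simp only: U V m(1) m'(1))
    then show False using m(2) m'(2) e f by auto
  next
    assume U: "B # X @ [Bi] = map fl ?U" and V: "B # Y @ [Bi] = map fl ?V"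
    have "- (- act [e] (- (- act [f] 0 + m')) + m) = 0"
      using closed by (simp only: U V act_fl m(1) m'(1))
    then show False using m(2) m'(2) e f by auto
  next
    assume "B # X @ [Bi] = ?U" "B # Y @ [Bi] = map fl ?V"
    then show False using no_isometric_cycle_opposite_mountains[OF _ M M' e f] w by metis
  next
    assume U: "B # X @ [Bi] = map fl ?U" and V: "B # Y @ [Bi] = ?V"
    have "isometric_cycle (?U @ [fl e] @ map fl ?V @ [fl f])"
      using isometric_cycle_fl[OF w] unfolding U V by (simp add: o_def)
    from no_isometric_cycle_opposite_mountains[OF this M M'] e f show False by auto
  qed
qed

section \<open>There are no isometric cycles of length at least six\<close>

lemma no_isometric_cycle: "\<not> isometric_cycle w"
proof
  assume "isometric_cycle w"
  then have "hgt w = 0" by (intro hgt_eq_0) (simp add: isometric_cycle_def)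
  then obtain p q where "w = p @ q" "dyck (q @ p)" using dyck_rotation by blast
  then obtain w' where w': "isometric_cycle w'" "dyck w'"
    using isometric_cycle_rotate \<open>isometric_cycle w\<close> by blast
  have "w' \<noteq> replicate k A" "w' \<noteq> replicate k Ai" for k
    using w'(1) by (auto simp: isometric_cycle_def fun_eq_iff)
  with isometric_cycle_dyck_cases[of w' "[]" "[]"] w' obtain s X v where
    X: "s \<in> {[], [A], [Ai]}" "w' = s @ B # X @ Bi # v" "dyck X" "dyck v" by auto
  \<comment> \<open>Moving \<open>s\<close> to the end makes the cycle start with an
    excursion.\<close>
  let ?v = "v @ s"
  have cyc: "isometric_cycle (B # X @ Bi # ?v)"
    using isometric_cycle_rotate[of s "B # X @ Bi # v"] w'(1) X(2) by simp
  have "dyck ?v" using X by (intro dyck_append) (auto intro: dyck.intros)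
  note no = not_isometric_cycle_shortenable
  \<comment> \<open>If \<open>t\<close> were empty, the last b^-1 would cyclically meet the initial
    b.\<close>
  have next_excursion: "\<exists>e\<in>{A, Ai}. t = [e] \<or> (\<exists>Y u. t = e # B # Y @ Bi # u \<and> dyck Y \<and> dyck u)"
    if "isometric_cycle (B # p @ Bi # t)" "dyck t" for p t
  proof -
    have "t \<noteq> []"
      using isometric_cycle_rotate[of "B # p" "[Bi]"] that(1) no[of "[Bi, B]" "[]" p]
      by (auto simp: shortenable_def)
    then show ?thesis
      using isometric_cycle_after_descent[of t "B # p" "[]"] that by auto
  qed
  obtain m where m: "\<And>y. act X y = y + real_of_int m" using dyck_act[OF X(3)] by blast
  have closed: "act (B # X @ Bi # ?v) 0 = 0" using cyc by (simp add: isometric_cycle_def)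
  from next_excursion[OF cyc \<open>dyck ?v\<close>] obtain e where e: "e \<in> {A, Ai}" and
    e_cases: "?v = [e] \<or> (\<exists>Y u. ?v = e # B # Y @ Bi # u \<and> dyck Y \<and> dyck u)" by blast
  \<comment> \<open>Excursions contribute even exponents and separators \<plusminus>1, so one or
    three excursions cannot close up.\<close>
  have odd: "2 * real_of_int n \<noteq> 1" "2 * real_of_int n \<noteq> - 1" for n
  proof -
    have "2 * n \<noteq> 1" "2 * n \<noteq> - 1" by presburger+
    then show "2 * real_of_int n \<noteq> 1" "2 * real_of_int n \<noteq> - 1"
      by (metis of_int_eq_iff of_int_mult of_int_numeral of_int_1 of_int_minus)+
  qed
  have "?v \<noteq> [e]"
  proof
    assume v: "?v = [e]"
    show False using closed e odd[of m] unfolding v by (auto simp: m)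
  qed
  with e_cases obtain Y u where Y: "?v = e # B # Y @ Bi # u" "dyck Y" "dyck u" by blast
  obtain m' where m': "\<And>y. act Y y = y + real_of_int m'" using dyck_act[OF Y(2)] by blast
  have "isometric_cycle (B # (X @ Bi # e # B # Y) @ Bi # u)" using cyc Y(1) by simp
  from next_excursion[OF this Y(3)] obtain f where f: "f \<in> {A, Ai}" and
    f_cases: "u = [f] \<or> (\<exists>Z t. u = f # B # Z @ Bi # t \<and> dyck Z \<and> dyck t)" by blast
  have "u \<noteq> [f]"
    using no_isometric_cycle_two_excursions[of X e Y f] X(3) Y e f cyc by auto
  with f_cases obtain Z t where Z: "u = f # B # Z @ Bi # t" "dyck Z" "dyck t" by blast
  obtain n where n: "\<And>y. act Z y = y + real_of_int n" using dyck_act[OF Z(2)] by blast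
  have "isometric_cycle (B # (X @ Bi # e # B # Y @ Bi # f # B # Z) @ Bi # t)"
    using cyc Y(1) Z(1) by simp
  from next_excursion[OF this Z(3)] obtain g where g: "g \<in> {A, Ai}" and
    g_cases: "t = [g] \<or> (\<exists>V r. t = g # B # V @ Bi # r \<and> dyck V \<and> dyck r)" by blast
  have "t \<noteq> [g]"
  proof
    assume "t = [g]"
    then have v: "?v = e # B # Y @ Bi # f # B # Z @ Bi # [g]" using Y Z by simp
    show False using closed e f g odd[of "m + m' + n"] odd[of "m + m' + n + 1"] odd[of "m + m' + n - 1"]
      unfolding v by (auto simp: m m' n add_divide_distrib diff_divide_distrib)
  qed
  with g_cases obtain V r where V: "t = g # B # V @ Bi # r" "dyck V" by blast
  \<comment> \<open>The pairs \<open>X\<close>, \<open>Y\<close> and \<open>Z\<close>,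
    \<open>V\<close> span disjoint segments. Each complement contains the other segment but may not
    exceed the shortened one, so the two bounds contradict each other.\<close>
  have "isometric_cycle ([] @ (B # X @ Bi # e # B # Y @ [Bi]) @
      (f # B # Z @ Bi # g # B # V @ Bi # r))"
    using cyc Y Z V by simp
  note 1 = isometric_cycle_adjacent_excursions[OF this X(3) Y(2) e]
  have "isometric_cycle ((B # X @ Bi # e # B # Y @ [Bi, f]) @ (B # Z @ Bi # g # B # V @ [Bi]) @ r)"
    using cyc Y Z V by simp
  note 2 = isometric_cycle_adjacent_excursions[OF this Z(2) V(2) g]
  from 1 2 show False by simp
qed

section \<open>Chordality from the absence of isometric cycles\<close>

theorem theorem12:
  shows "k_chordal bs_eq 6"
  unfolding k_chordal_def
proof (intro allI impI, elim conjE)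
  fix w assume simple: "simple_relation bs_eq w" and len: "6 \<le> length w"
  have nontriv: "nontriv bs_eq x" for x
    by (cases x) (auto simp: nontriv_def bs_eq_iff_act fun_eq_iff intro!: exI[of _ 1])
  have "bs_eq (seg w 0 (length w - 1)) []"
    using simple len unfolding simple_relation_def by auto
  then have "act w = id" using len by (simp add: bs_eq_iff_act seg_def fun_eq_iff)
  with no_isometric_cycle[of w] len obtain x u y v where
    w: "w = x @ u @ y" and v: "act v = act u" "length v < length u" "length v < length x + length y"
    unfolding isometric_cycle_def by (auto simp: not_le)
  \<comment> \<open>Chordality asks for i < j, so \<open>u\<close> needs two letters; a single
    letter with a shorter \<open>v\<close> would be trivial.\<close>
  have "length u \<noteq> 1"
  proof
    assume "length u = 1"
    then obtain z where "u = [z]" by (auto simp: length_Suc_conv)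
    with v(1,2) nontriv[of z] show False by (simp add: nontriv_def bs_eq_iff_act)
  qed
  with v(2) have "2 \<le> length u" by (cases "length u") auto
  then have "length x < length x + length u - 1" "length x + length u - 1 < length w"
    "seg w (length x) (length x + length u - 1) = u"
    using w by (auto simp: seg_def)
  \<comment> \<open>With these indices the two bounds are \<open>length u - 1\<close> and
    \<open>length x + length y - 1\<close>, matching the strict inequalities for
    \<open>v\<close>.\<close>
  moreover have "int (length v) \<le> min (int (length x + length u - 1) - int (length x))
      (int (length w) - int (length x + length u - 1) + int (length x) - 2)"
    using v(2,3) w \<open>2 \<le> length u\<close> by (auto simp: of_nat_diff)
  ultimately show "\<exists>i j w'. i < j \<and> j < length w \<and> (\<forall>x\<in>set w'. nontriv bs_eq x) \<and>
      bs_eq (seg w i j) w' \<and>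
      int (length w') \<le> min (int j - int i) (int (length w) - int j + int i - 2)"
    using v(1) nontriv unfolding bs_eq_iff_act by metis
qed

end
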